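(* Let $X=(X_t)_{t\ge 0}$ and $Y=(Y_t)_{t\ge 0}$ be stochastic processes with values in $E=\{e_1,\dots,e_n\}$ and $F=\{f_1,\dots,f_m\}$ respectively, forming a hidden Markov chain with parameters $A\in\mathbb{R}^{n\times n}$, $G\in\mathbb{R}^{m\times n}$ and initial law $p_0=EX_0$: with $Z_t=Y_t\otimes X_t$, $E[Z_{t+1}|\mathcal{F}_t]=\Delta(G)AX_t$ for all $t\ge0$ and $EZ_0=\Delta(G)p_0$. Then, almost surely: (i) The conditional distribution of $X_t$ given $Y_0,\dots,Y_t$, represented by $\hat X_t=E[X_t|\mathcal{F}^Y_t]$, is recursively determined for $t\ge1$ by $$\hat X_t=\mathrm{diag}(A\hat X_{t-1})\,G^\top\,\mathrm{diag}(GA\hat X_{t-1})^{-1}Y_t,$$ with initial condition $\hat X_0=\mathrm{diag}(p_0)\,G^\top\,\mathrm{diag}(Gp_0)^{-1}Y_0$. (ii) The conditional distribution of $X_t$ given $Y_0,\dots,Y_{t-1}$, represented by $\hat X_{t|t-1}=E[X_t|\mathcal{F}^Y_{t-1}]$, is recursively determined for $t\ge0$ by $$\hat X_{t+1|t}=A\,\mathrm{diag}(\hat X_{t|t-1})\,G^\top\,\mathrm{diag}(G\hat X_{t|t-1})^{-1}Y_t,$$ with initial condition $\hat X_{0|-1}=EX_0=p_0$. (iii) The conditional expectation $\hat Y_{t+1|t}=E[Y_{t+1}|\mathcal{F}^Y_t]$ is given for $t\ge0$ by $$\hat Y_{t+1|t}=GA\,\mathrm{diag}(\hat X_{t|t-1})\,G^\top\,\mathrm{diag}(G\hat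 X_{t|t-1})^{-1}Y_t.$$
   Context: All random variables live on a probability space $(\Omega,\mathcal{F},P)$; equalities of conditional expectations hold almost surely. $e_1,\dots,e_n$ are the standard basis vectors of $\mathbb{R}^n$ and $f_1,\dots,f_m$ those of $\mathbb{R}^m$; $\otimes$ is the Kronecker product. $A$ and $G$ have nonnegative entries and columns summing to one ($A_{ij}$ is the probability that $X$ moves from $e_j$ to $e_i$; $G_{ji}$ is the probability of output $f_j$ in state $e_i$). $\mathcal{F}_t=\sigma\{X_0,\dots,X_t,Y_0,\dots,Y_t\}$, $\mathcal{F}^Y_t=\sigma\{Y_0,\dots,Y_t\}$, $\mathcal{F}^Y_{-1}$ trivial. For $G$ with rows $G_{1\cdot},\dots,G_{m\cdot}$, $\Delta(G)\in\mathbb{R}^{nm\times n}$ is obtained by stacking the $n\times n$ diagonal matrices $\mathrm{diag}(G_{1\cdot}),\dots,\mathrm{diag}(G_{m\cdot})$ one underneath the other. $\mathrm{diag}(v)$ is the diagonal matrix with the entries of $v$ on the diagonal; in $\mathrm{diag}(v)^{-1}$ the inverse of a zero diagonal entry may be given any value (e.g. zero), since almost surely the vector $Y_t$ to which it is applied does not select such an entry. *)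

theory Defs
  imports "HOL-Probability.Probability"
begin

definition basis_vectors :: "(real ^ 'k) set" where
  "basis_vectors = range (\<lambda>i. axis i 1)"

definition diag :: "real ^ 'k \<Rightarrow> real ^ 'k ^ 'k" where
  "diag v = (\<chi> i j. if i = j then v $ i else 0)"

text \<open>The inverse of \<^term>\<open>diag v\<close>, where the inverse of a zero diagonal entry in position
  \<^term>\<open>i\<close> is assigned the value \<^term>\<open>c $ i\<close>.\<close>

definition diag_inv :: "real ^ 'k \<Rightarrow> real ^ 'k \<Rightarrow> real ^ 'k ^ 'k" where
  "diag_inv c v = diag (\<chi> i. if v $ i = 0 then c $ i else inverse (v $ i))"

definition column_stochastic :: "real ^ 'c ^ 'r \<Rightarrow> bool" where
  "column_stochastic B \<longleftrightarrow> (\<forall>i j. 0 \<le> B $ i $ j) \<and> (\<forall>j. (\<Sum>i\<in>UNIV. B $ i $ j) = 1)"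

text \<open>Vectors and matrices with \<open>m \<cdot> n\<close> rows have their rows indexed by pairs: the first component
  is the number of the block, the second one is the position inside the block.\<close>

definition kron_vec :: "real ^ 'm \<Rightarrow> real ^ 'n \<Rightarrow> real ^ ('m \<times> 'n)" where
  "kron_vec y x = (\<chi> r. y $ fst r * x $ snd r)"

definition Delta :: "real ^ 'n ^ 'm \<Rightarrow> real ^ 'n ^ ('m \<times> 'n)" where
  "Delta G = (\<chi> r. diag (G $ fst r) $ snd r)"

text \<open>The events \<open>W\<^sub>s \<in> B\<close> for \<open>s \<in> I\<close> and Borel sets \<open>B\<close>.\<close>

definition generating_events ::
  "'a measure \<Rightarrow> (nat \<Rightarrow> 'a \<Rightarrow> 'b::topological_space) \<Rightarrow> nat set \<Rightarrow> 'a set set" where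
  "generating_events M W I = {W s -` B \<inter> space M | s B. s \<in> I \<and> B \<in> sets borel}"

definition joint_history ::
  "'a measure \<Rightarrow> (nat \<Rightarrow> 'a \<Rightarrow> real ^ 'n) \<Rightarrow> (nat \<Rightarrow> 'a \<Rightarrow> real ^ 'm) \<Rightarrow> nat \<Rightarrow> 'a measure" where
  "joint_history M X Y t =
     sigma (space M) (generating_events M X {..t} \<union> generating_events M Y {..t})"

text \<open>The sigma-algebra generated by \<open>Y\<^sub>s\<close>, \<open>s \<in> I\<close>.  The history up to time \<open>t\<close> is obtained for
  \<open>I = {..t}\<close>, the one up to time \<open>t - 1\<close> for \<open>I = {..<t}\<close>; for \<open>t = 0\<close> the latter is trivial.\<close>

definition obs_history ::
  "'a measure \<Rightarrow> (nat \<Rightarrow> 'a \<Rightarrow> real ^ 'm) \<Rightarrow> nat set \<Rightarrow> 'a measure" where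
  "obs_history M Y I = sigma (space M) (generating_events M Y I)"

definition vec_cond_exp :: "'a measure \<Rightarrow> 'a measure \<Rightarrow> ('a \<Rightarrow> real ^ 'k) \<Rightarrow> 'a \<Rightarrow> real ^ 'k" where
  "vec_cond_exp M F V = (\<lambda>\<omega>. \<chi> i. real_cond_exp M F (\<lambda>\<omega>'. V \<omega>' $ i) \<omega>)"

text \<open>For a random vector \<open>V\<close> with values in the standard basis: the random vector \<open>Q\<close> is almost
  surely the vector of point masses of the conditional distribution of \<open>V\<close> given \<open>F\<close>.\<close>

definition represents_cond_distr ::
  "'a measure \<Rightarrow> 'a measure \<Rightarrow> ('a \<Rightarrow> real ^ 'k) \<Rightarrow> ('a \<Rightarrow> real ^ 'k) \<Rightarrow> bool" where
  "represents_cond_distr M F V Q \<longleftrightarrow>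
     (AE \<omega> in M. (\<forall>i. 0 \<le> Q \<omega> $ i) \<and> (\<Sum>i\<in>UNIV. Q \<omega> $ i) = 1 \<and>
       (\<forall>i. Q \<omega> $ i = real_cond_exp M F (indicator {\<omega>' \<in> space M. V \<omega>' = axis i 1}) \<omega>))"

locale hidden_markov_chain = prob_space M
  for M :: "'a measure" +
  fixes X :: "nat \<Rightarrow> 'a \<Rightarrow> real ^ 'n"
    and Y :: "nat \<Rightarrow> 'a \<Rightarrow> real ^ 'm"
    and A :: "real ^ 'n ^ 'n"
    and G :: "real ^ 'n ^ 'm"
    and p0 :: "real ^ 'n"
  assumes X_measurable: "\<And>t. X t \<in> borel_measurable M"
    and Y_measurable: "\<And>t. Y t \<in> borel_measurable M"
    and X_values: "\<And>t \<omega>. \<omega> \<in> space M \<Longrightarrow> X t \<omega> \<in> basis_vectors"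
    and Y_values: "\<And>t \<omega>. \<omega> \<in> space M \<Longrightarrow> Y t \<omega> \<in> basis_vectors"
    and A_stochastic: "column_stochastic A"
    and G_stochastic: "column_stochastic G"
    and initial_law: "p0 = expectation (X 0)"
    and transition: "\<And>t. AE \<omega> in M.
      vec_cond_exp M (joint_history M X Y t) (\<lambda>\<omega>'. kron_vec (Y (Suc t) \<omega>') (X (Suc t) \<omega>')) \<omega>
        = (Delta G ** A) *v X t \<omega>"
    and initial_joint: "expectation (\<lambda>\<omega>. kron_vec (Y 0 \<omega>) (X 0 \<omega>)) = Delta G *v p0"

end

theory Submission
  imports Defs
begin

text \<open>Let \<open>H\<close> be the observation history before time \<open>t\<close> and \<open>p = E[X\<^sub>t | H]\<close>.  The model gives
  \<open>E[Y\<^sub>t\<^sub>j X\<^sub>t\<^sub>i | H] = G\<^sub>j\<^sub>i p\<^sub>i\<close>, for \<open>t > 0\<close> by the tower property.  On the event \<open>Y\<^sub>t = f\<^sub>j\<close> the history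
  including \<open>Y\<^sub>t\<close> has the same trace as \<open>H\<close>, so conditioning on it is Bayes' rule: the filtered
  probability of state \<open>i\<close> is \<open>G\<^sub>j\<^sub>i p\<^sub>i / (G p)\<^sub>j\<close>.  All recursions follow from this update and the
  prediction steps \<open>E[X\<^sub>t\<^sub>+\<^sub>1 | Y\<^sub>0, \<dots>, Y\<^sub>t] = A E[X\<^sub>t | Y\<^sub>0, \<dots>, Y\<^sub>t]\<close> and
  \<open>E[Y\<^sub>t\<^sub>+\<^sub>1 | Y\<^sub>0, \<dots>, Y\<^sub>t] = G A E[X\<^sub>t | Y\<^sub>0, \<dots>, Y\<^sub>t]\<close>.\<close>

section \<open>Coordinates of basis vectors, measurability, and entries of the filter
  matrices\<close>

lemma basis_vectors_nth:
  assumes "x \<in> basis_vectors"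
  shows "x $ i = 0 \<or> x $ i = 1"
  using assms by (auto simp: basis_vectors_def axis_def)

lemma basis_vectors_sum:
  fixes x :: "real ^ 'k"
  assumes "x \<in> basis_vectors"
  shows "(\<Sum>i\<in>UNIV. x $ i) = 1"
  using assms by (auto simp: basis_vectors_def axis_def)

text \<open>This links vectors with events: taking conditional expectations of the coordinates of a
  basis-valued vector yields the conditional probabilities of its values.\<close>

lemma basis_vectors_indicator:
  fixes x :: "real ^ 'k"
  assumes "x \<in> basis_vectors"
  shows "x $ i = indicator {axis i 1} x"
  using assms by (auto simp: basis_vectors_def indicator_def axis_eq_axis) (simp add: axis_def)

lemma borel_measurable_vec_nth [measurable (raw)]:
  fixes V :: "'a \<Rightarrow> real ^ 'k"
  assumes "V \<in> borel_measurable M"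
  shows "(\<lambda>\<omega>. V \<omega> $ i) \<in> borel_measurable M"
  by (rule borel_measurable_continuous_on[OF _ assms]) (intro continuous_intros)

lemma borel_measurable_vecI:
  fixes V :: "'a \<Rightarrow> real ^ 'k"
  assumes "\<And>i. (\<lambda>\<omega>. V \<omega> $ i) \<in> borel_measurable M"
  shows "V \<in> borel_measurable M"
  unfolding borel_measurable_euclidean_space[where f = V]
  using assms by (auto simp: Basis_vec_def inner_axis)

text \<open>Both diagonal factors collapse the inner sums to one term each, leaving only the sum
  over outputs. The value \<open>c\<close> shows up exactly at the indices \<open>j\<close> with
  \<open>q $ j = 0\<close>, which confines its influence to the factors \<open>y $ j\<close> at
  those indices.\<close>

lemma filter_matrix_nth:
  "((diag p ** transpose G ** diag_inv c q) *v y) $ i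
    = (\<Sum>j\<in>UNIV. p $ i * G $ j $ i * (if q $ j = 0 then c $ j else inverse (q $ j)) * y $ j)"
  by (simp add: matrix_vector_mult_def matrix_matrix_mult_def diag_def diag_inv_def transpose_def
      if_distrib [of "\<lambda>a. a * _"] if_distrib [of "\<lambda>a. _ * a"] cong: if_cong)

text \<open>Block \<open>j\<close> of \<open>Delta G\<close> is the diagonal matrix of row
  \<open>j\<close> of \<open>G\<close>, so a single column survives in row \<open>(j, i)\<close>. If
  \<open>x\<close> is a state distribution, this is the joint probability of output \<open>j\<close>
  and state \<open>i\<close>.\<close>

lemma Delta_mult_nth: "(Delta G *v x) $ (j, i) = G $ j $ i * x $ i"
  by (simp add: matrix_vector_mult_def Delta_def diag_def if_distrib [of "\<lambda>a. a * _"] cong: if_cong)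

section \<open>Conditional expectations of basis-valued random vectors\<close>

lemma (in prob_space) sigma_finite_subalgebraI:
  assumes "subalgebra M F"
  shows "sigma_finite_subalgebra M F"
  by (rule finite_measure_subalgebra_is_sigma_finite)
    (unfold_locales, rule assms)

lemma (in prob_space) integrable_basis_nth:
  fixes V :: "'a \<Rightarrow> real ^ 'k"
  assumes [measurable]: "V \<in> borel_measurable M"
    and "V \<in> space M \<rightarrow> basis_vectors"
  shows "integrable M (\<lambda>\<omega>. V \<omega> $ i)"
proof (rule integrable_const_bound[where B = 1])
  show "AE \<omega> in M. norm (V \<omega> $ i) \<le> 1"
    using basis_vectors_nth[OF funcset_mem[OF assms(2)], of _ i] by (intro AE_I2) fastforce
qed measurable

lemma (in prob_space) integrable_basis_mult:
  fixes V :: "'a \<Rightarrow> real ^ 'k" and W :: "'a \<Rightarrow> real ^ 'l"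
  assumes [measurable]: "V \<in> borel_measurable M" "W \<in> borel_measurable M"
    and V: "V \<in> space M \<rightarrow> basis_vectors"
    and W: "W \<in> space M \<rightarrow> basis_vectors"
  shows "integrable M (\<lambda>\<omega>. W \<omega> $ j * V \<omega> $ i)"
proof (rule integrable_const_bound[where B = 1])
  show "AE \<omega> in M. norm (W \<omega> $ j * V \<omega> $ i) \<le> 1"
    using basis_vectors_nth[OF funcset_mem[OF V], of _ i] basis_vectors_nth[OF funcset_mem[OF W], of _ j] by (intro AE_I2) fastforce
qed measurable

text \<open>The coordinates of \<open>V\<close> are nonnegative and sum to one, and conditional
  expectation preserves both facts. Nonnegativity is what later controls the quotients in Bayes'
  rule.\<close>

lemma (in prob_space) vec_cond_exp_basis:
  fixes V :: "'a \<Rightarrow> real ^ 'k"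
  assumes F: "subalgebra M F"
    and V [measurable]: "V \<in> borel_measurable M"
    and basis: "V \<in> space M \<rightarrow> basis_vectors"
  shows "AE \<omega> in M. (\<forall>i. 0 \<le> vec_cond_exp M F V \<omega> $ i) \<and> (\<Sum>i\<in>UNIV. vec_cond_exp M F V \<omega> $ i) = 1"
proof -
  interpret F: sigma_finite_subalgebra M F
    using F by (rule sigma_finite_subalgebraI)
  have "AE \<omega> in M. \<forall>i. 0 \<le> real_cond_exp M F (\<lambda>\<omega>. V \<omega> $ i) \<omega>"
  proof (subst AE_all_countable, intro allI F.real_cond_exp_pos AE_I2)
    show "0 \<le> V \<omega> $ i" if "\<omega> \<in> space M" for i \<omega>
      using basis_vectors_nth[OF funcset_mem[OF basis that], of i] by auto
  qed measurable
  moreover have "AE \<omega> in M. real_cond_exp M F (\<lambda>\<omega>. \<Sum>i\<in>UNIV. V \<omega> $ i) \<omega>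
      = (\<Sum>i\<in>UNIV. real_cond_exp M F (\<lambda>\<omega>. V \<omega> $ i) \<omega>)"
    by (rule F.real_cond_exp_sum) (rule integrable_basis_nth[OF V basis])
  moreover have "AE \<omega> in M. real_cond_exp M F (\<lambda>\<omega>. \<Sum>i\<in>UNIV. V \<omega> $ i) \<omega> = real_cond_exp M F (\<lambda>_. 1) \<omega>"
    by (rule F.real_cond_exp_cong) (use basis in \<open>auto simp: basis_vectors_sum Pi_iff\<close>)
  moreover have "AE \<omega> in M. real_cond_exp M F (\<lambda>_. 1) \<omega> = 1"
    by (rule F.real_cond_exp_F_meas) auto
  ultimately show ?thesis
    by eventually_elim (simp add: vec_cond_exp_def)
qed

text \<open>The \<open>i\<close>-th coordinate of \<open>V\<close> is the indicator of the event
  that \<open>V\<close> equals the \<open>i\<close>-th basis vector, so its conditional expectation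
  is a conditional probability.\<close>

lemma (in prob_space) represents_cond_distr_vec_cond_exp:
  fixes V :: "'a \<Rightarrow> real ^ 'k"
  assumes F: "subalgebra M F"
    and V [measurable]: "V \<in> borel_measurable M"
    and basis: "V \<in> space M \<rightarrow> basis_vectors"
  shows "represents_cond_distr M F V (vec_cond_exp M F V)"
proof -
  interpret F: sigma_finite_subalgebra M F
    using F by (rule sigma_finite_subalgebraI)
  have "AE \<omega> in M. \<forall>i. real_cond_exp M F (\<lambda>\<omega>. V \<omega> $ i) \<omega>
      = real_cond_exp M F (indicator {\<omega>' \<in> space M. V \<omega>' = axis i 1}) \<omega>"
  proof (subst AE_all_countable, intro allI F.real_cond_exp_cong AE_I2)
    show "V \<omega> $ i = indicator {\<omega>' \<in> space M. V \<omega>' = axis i 1} \<omega>" if "\<omega> \<in> space M" for i \<omega>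
      using basis_vectors_indicator[OF funcset_mem[OF basis that], of i] that by (simp add: indicator_def)
  qed measurable
  then show ?thesis
    using vec_cond_exp_basis[OF assms] unfolding represents_cond_distr_def
    by eventually_elim (simp add: vec_cond_exp_def)
qed

section \<open>Refining the conditioning: Bayes' rule\<close>

text \<open>A set of \<open>K\<close> agrees with one of \<open>H\<close> wherever \<open>u\<close> or \<open>w\<close> does not vanish, so integrals of
  these functions over it can be evaluated by conditioning on \<open>H\<close>.\<close>

lemma (in prob_space) real_cond_exp_refine:
  fixes u w h :: "'a \<Rightarrow> real"
  assumes K: "subalgebra M K" and HK: "subalgebra K H"
    and trace: "\<And>C. C \<in> sets K \<Longrightarrow> \<exists>D\<in>sets H. C \<inter> N = D \<inter> N"
    and u0: "\<And>\<omega>. \<omega> \<in> space M \<Longrightarrow> \<omega> \<notin> N \<Longrightarrow> u \<omega> = 0"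
    and w0: "\<And>\<omega>. \<omega> \<in> space M \<Longrightarrow> \<omega> \<notin> N \<Longrightarrow> w \<omega> = 0"
    and u: "integrable M u"
    and w: "w \<in> borel_measurable K"
    and h: "h \<in> borel_measurable H"
    and hw: "integrable M (\<lambda>\<omega>. h \<omega> * w \<omega>)"
    and eq: "AE \<omega> in M. real_cond_exp M H u \<omega> = h \<omega> * real_cond_exp M H w \<omega>"
  shows "AE \<omega> in M. real_cond_exp M K u \<omega> = h \<omega> * w \<omega>"
proof -
  have H: "subalgebra M H"
    using K HK by (auto simp: subalgebra_def)
  interpret K: sigma_finite_subalgebra M K
    using K by (rule sigma_finite_subalgebraI)
  interpret H: sigma_finite_subalgebra M H
    using H by (rule sigma_finite_subalgebraI)
  have [measurable]: "h \<in> borel_measurable K"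
    using HK h by (rule measurable_from_subalg)
  show ?thesis
  proof (rule K.real_cond_exp_charact)
    fix C assume C: "C \<in> sets K"
    obtain D where D: "D \<in> sets H" "C \<inter> N = D \<inter> N"
      using trace[OF C] by blast
    have DM [measurable]: "D \<in> sets M"
      using D(1) H by (auto simp: subalgebra_def)
    \<comment> \<open>Off \<open>N\<close> both functions vanish, and on \<open>N\<close> membership
      in \<open>C\<close> and in \<open>D\<close> coincide, so \<open>C\<close> can be traded for
      the set \<open>D\<close> of the coarser sigma-algebra.\<close>
    have ind: "indicator C \<omega> * u \<omega> = indicator D \<omega> * u \<omega>"
      "indicator C \<omega> * (h \<omega> * w \<omega>) = indicator D \<omega> * (h \<omega> * w \<omega>)" if "\<omega> \<in> space M" for \<omega>
    proof -
      have "u \<omega> = 0 \<and> w \<omega> = 0 \<or> (\<omega> \<in> C \<longleftrightarrow> \<omega> \<in> D)"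
        using D(2) u0[OF that] w0[OF that] by blast
      then show "indicator C \<omega> * u \<omega> = indicator D \<omega> * u \<omega>"
        "indicator C \<omega> * (h \<omega> * w \<omega>) = indicator D \<omega> * (h \<omega> * w \<omega>)"
        by (auto simp: indicator_def)
    qed
    have ihw: "integrable M (\<lambda>\<omega>. (indicator D \<omega> * h \<omega>) * w \<omega>)"
      using integrable_mult_indicator[OF DM hw] by (simp add: mult_ac)
    have iu: "integrable M (\<lambda>\<omega>. indicator D \<omega> * u \<omega>)"
      using integrable_mult_indicator[OF DM u] by simp
    have "(\<integral>\<omega>\<in>C. u \<omega> \<partial>M) = (\<integral>\<omega>. indicator D \<omega> * u \<omega> \<partial>M)"
      unfolding set_lebesgue_integral_def by (rule Bochner_Integration.integral_cong) (simp_all add: ind)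
    \<comment> \<open>As \<open>D\<close> lies in \<open>H\<close>, \<open>u\<close> may be replaced
      by its conditional expectation given \<open>H\<close>, to which \<open>eq\<close> applies. The
      conditioning of \<open>w\<close> is then undone, because \<open>indicator D\<close> times
      \<open>h\<close> is \<open>H\<close>-measurable.\<close>
    also have "\<dots> = (\<integral>\<omega>. indicator D \<omega> * real_cond_exp M H u \<omega> \<partial>M)"
      by (rule H.real_cond_exp_intg(2)[symmetric]) (use iu u D(1) in auto)
    also have "\<dots> = (\<integral>\<omega>. (indicator D \<omega> * h \<omega>) * real_cond_exp M H w \<omega> \<partial>M)"
    proof (rule integral_cong_AE)
      have [measurable]: "h \<in> borel_measurable M"
        using H h by (rule measurable_from_subalg)
      show "(\<lambda>\<omega>. indicator D \<omega> * real_cond_exp M H u \<omega>) \<in> borel_measurable M"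
        "(\<lambda>\<omega>. indicator D \<omega> * h \<omega> * real_cond_exp M H w \<omega>) \<in> borel_measurable M"
        by measurable
      show "AE \<omega> in M. indicator D \<omega> * real_cond_exp M H u \<omega>
          = indicator D \<omega> * h \<omega> * real_cond_exp M H w \<omega>"
        using eq by eventually_elim simp
    qed
    also have "\<dots> = (\<integral>\<omega>. (indicator D \<omega> * h \<omega>) * w \<omega> \<partial>M)"
      by (rule H.real_cond_exp_intg(2)) (use ihw D(1) h measurable_from_subalg[OF K w] in auto)
    also have "\<dots> = (\<integral>\<omega>\<in>C. h \<omega> * w \<omega> \<partial>M)"
      unfolding set_lebesgue_integral_def
      by (rule Bochner_Integration.integral_cong) (simp_all add: ind mult.assoc)
    finally show "(\<integral>\<omega>\<in>C. u \<omega> \<partial>M) = (\<integral>\<omega>\<in>C. h \<omega> * w \<omega> \<partial>M)" .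
  qed (use u hw w in auto)
qed

text \<open>Write \<open>V $ i\<close> as the sum over \<open>j\<close> of
  \<open>W $ j * V $ i\<close>. Each summand lives on the event that \<open>W\<close> is the
  \<open>j\<close>-th basis vector, where \<open>K\<close> has the same trace as \<open>H\<close>,
  so \<open>real_cond_exp_refine\<close> gives its conditional expectation as a quotient of
  \<open>H\<close>-measurable quantities times \<open>W $ j\<close>. The quantifier over
  \<open>c\<close> stands inside the almost sure statement: one null set serves all default values,
  although there are uncountably many.\<close>

lemma (in prob_space) bayes_update:
  fixes V :: "'a \<Rightarrow> real ^ 'n" and W :: "'a \<Rightarrow> real ^ 'm" and G :: "real ^ 'n ^ 'm"
  assumes K: "subalgebra M K" and HK: "subalgebra K H"
    and trace: "\<And>C j. C \<in> sets K \<Longrightarrow>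
      \<exists>D\<in>sets H. C \<inter> {\<omega> \<in> space M. W \<omega> = axis j 1} = D \<inter> {\<omega> \<in> space M. W \<omega> = axis j 1}"
    and V [measurable]: "V \<in> borel_measurable M"
    and W: "W \<in> borel_measurable K"
    and Vb: "V \<in> space M \<rightarrow> basis_vectors"
    and Wb: "W \<in> space M \<rightarrow> basis_vectors"
    and G: "\<And>i j. 0 \<le> G $ j $ i"
    and joint: "\<And>i j. AE \<omega> in M.
      real_cond_exp M H (\<lambda>\<omega>. W \<omega> $ j * V \<omega> $ i) \<omega> = G $ j $ i * vec_cond_exp M H V \<omega> $ i"
  shows "AE \<omega> in M. \<forall>c. vec_cond_exp M K V \<omega> =
    (diag (vec_cond_exp M H V \<omega>) ** transpose G ** diag_inv c (G *v vec_cond_exp M H V \<omega>)) *v W \<omega>"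
proof -
  define p where "p = vec_cond_exp M H V"
  \<comment> \<open>This is the posterior probability of state \<open>i\<close> after output
    \<open>j\<close>. Its value at a zero denominator is 0, by the convention for
    \<open>inverse\<close>; general values \<open>c\<close> enter only at the end.\<close>
  define h where "h i j \<omega> = p \<omega> $ i * G $ j $ i * inverse ((G *v p \<omega>) $ j)" for i j \<omega>
  have H: "subalgebra M H"
    using K HK by (auto simp: subalgebra_def)
  interpret K: sigma_finite_subalgebra M K
    using K by (rule sigma_finite_subalgebraI)
  interpret H: sigma_finite_subalgebra M H
    using H by (rule sigma_finite_subalgebraI)
  have WM [measurable]: "W \<in> borel_measurable M"
    using K W by (rule measurable_from_subalg)
  have p_nn: "AE \<omega> in M. \<forall>i. 0 \<le> p \<omega> $ i"
    using vec_cond_exp_basis[OF H V Vb] unfolding p_def by eventually_elim simp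
  have p_meas [measurable]: "(\<lambda>\<omega>. p \<omega> $ i) \<in> borel_measurable H" for i
    unfolding p_def vec_cond_exp_def by simp
  have Gp_meas [measurable]: "(\<lambda>\<omega>. (G *v p \<omega>) $ j) \<in> borel_measurable H" for j
    unfolding matrix_vector_mult_def by simp
  have h_meas [measurable]: "h i j \<in> borel_measurable H" for i j
    unfolding h_def by measurable
  have h_meas_M [measurable]: "h i j \<in> borel_measurable M" for i j
    using H h_meas by (rule measurable_from_subalg)
  have Gp_ge: "p \<omega> $ i * G $ j $ i \<le> (G *v p \<omega>) $ j" if "\<forall>i. 0 \<le> p \<omega> $ i" for i j \<omega>
    using that G member_le_sum[of i UNIV "\<lambda>i. G $ j $ i * p \<omega> $ i"]
    by (simp add: matrix_vector_mult_def mult.commute)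
  have Gp_nn: "0 \<le> (G *v p \<omega>) $ j" if "\<forall>i. 0 \<le> p \<omega> $ i" for j \<omega>
    using that G by (simp add: matrix_vector_mult_def sum_nonneg)
  \<comment> \<open>A zero denominator is a vanishing sum of nonnegative terms, one of which is the
    numerator, so the identity holds there as well.\<close>
  have h_cancel: "h i j \<omega> * (G *v p \<omega>) $ j = p \<omega> $ i * G $ j $ i" if "\<forall>i. 0 \<le> p \<omega> $ i" for i j \<omega>
  proof (cases "(G *v p \<omega>) $ j = 0")
    case True
    then have "p \<omega> $ i * G $ j $ i = 0"
      using Gp_ge[OF that, of i j] mult_nonneg_nonneg[OF that[rule_format, of i] G[of j i]] by linarith
    then show ?thesis
      by (simp add: True)
  qed (simp add: h_def)
  \<comment> \<open>The quotient compares one nonnegative summand with the whole sum. The bound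
    provides the integrability of \<open>h i j\<close> times \<open>W $ j\<close>.\<close>
  have h_bound: "\<bar>h i j \<omega>\<bar> \<le> 1" if "\<forall>i. 0 \<le> p \<omega> $ i" for i j \<omega>
    using Gp_ge[OF that, of i j] Gp_nn[OF that, of j] that G
    by (auto simp: h_def abs_mult divide_simps mult_le_cancel_left split: if_splits)
  have iV: "integrable M (\<lambda>\<omega>. V \<omega> $ i)" for i
    by (rule integrable_basis_nth[OF V Vb])
  have iW: "integrable M (\<lambda>\<omega>. W \<omega> $ j)" for j
    by (rule integrable_basis_nth[OF WM Wb])
  have iWV: "integrable M (\<lambda>\<omega>. W \<omega> $ j * V \<omega> $ i)" for i j
    by (rule integrable_basis_mult[OF V WM Vb Wb])
  have W_abs: "\<bar>W \<omega> $ j\<bar> \<le> 1" if "\<omega> \<in> space M" for j \<omega>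
    using basis_vectors_nth[OF funcset_mem[OF Wb that], of j] by auto
  \<comment> \<open>Since the coordinates of \<open>V\<close> sum to one, summing the joint law over
    the states gives the law of the output.\<close>
  have W_cond: "AE \<omega> in M. real_cond_exp M H (\<lambda>\<omega>. W \<omega> $ j) \<omega> = (G *v p \<omega>) $ j" for j
  proof -
    have "AE \<omega> in M. real_cond_exp M H (\<lambda>\<omega>. W \<omega> $ j) \<omega>
        = real_cond_exp M H (\<lambda>\<omega>. \<Sum>i\<in>UNIV. W \<omega> $ j * V \<omega> $ i) \<omega>"
      by (rule H.real_cond_exp_cong)
        (use Vb in \<open>auto simp: sum_distrib_left[symmetric] basis_vectors_sum Pi_iff\<close>)
    moreover have "AE \<omega> in M. real_cond_exp M H (\<lambda>\<omega>. \<Sum>i\<in>UNIV. W \<omega> $ j * V \<omega> $ i) \<omega>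
        = (\<Sum>i\<in>UNIV. real_cond_exp M H (\<lambda>\<omega>. W \<omega> $ j * V \<omega> $ i) \<omega>)"
      by (rule H.real_cond_exp_sum) (rule iWV)
    moreover have "AE \<omega> in M. \<forall>i. real_cond_exp M H (\<lambda>\<omega>. W \<omega> $ j * V \<omega> $ i) \<omega> = G $ j $ i * p \<omega> $ i"
      using joint by (simp add: AE_all_countable p_def)
    ultimately show ?thesis
      by eventually_elim (simp add: matrix_vector_mult_def)
  qed
  \<comment> \<open>Here \<open>real_cond_exp_refine\<close> is applied with \<open>N\<close> the
    event that \<open>W\<close> is the \<open>j\<close>-th basis vector; \<open>h_cancel\<close>
    turns the joint law into the required multiple of the law of \<open>W $ j\<close>.\<close>
  have component: "AE \<omega> in M. real_cond_exp M K (\<lambda>\<omega>. W \<omega> $ j * V \<omega> $ i) \<omega> = h i j \<omega> * W \<omega> $ j" for i j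
  proof (rule real_cond_exp_refine[OF K HK trace[of _ j]])
    show "W \<omega> $ j = 0" if "\<omega> \<in> space M" "\<omega> \<notin> {\<omega> \<in> space M. W \<omega> = axis j 1}" for \<omega>
      using that basis_vectors_indicator[OF funcset_mem[OF Wb], of \<omega> j] by simp
    then show "W \<omega> $ j * V \<omega> $ i = 0" if "\<omega> \<in> space M" "\<omega> \<notin> {\<omega> \<in> space M. W \<omega> = axis j 1}" for \<omega>
      using that by simp
    show "integrable M (\<lambda>\<omega>. h i j \<omega> * W \<omega> $ j)"
    proof (rule integrable_const_bound[where B = 1])
      show "AE \<omega> in M. norm (h i j \<omega> * W \<omega> $ j) \<le> 1"
        using p_nn AE_space
        by eventually_elim (simp add: abs_mult mult_le_one h_bound W_abs)
    qed measurable
    show "AE \<omega> in M. real_cond_exp M H (\<lambda>\<omega>. W \<omega> $ j * V \<omega> $ i) \<omega>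
        = h i j \<omega> * real_cond_exp M H (\<lambda>\<omega>. W \<omega> $ j) \<omega>"
      using W_cond[of j] joint[of j i] p_nn
      by eventually_elim (simp add: h_cancel p_def[symmetric])
  qed (use iWV W in auto)
  \<comment> \<open>Now the coordinates of \<open>W\<close> sum to one, so summing over the outputs
    recovers \<open>V\<close>.\<close>
  have V_cond: "AE \<omega> in M. \<forall>i. vec_cond_exp M K V \<omega> $ i = (\<Sum>j\<in>UNIV. h i j \<omega> * W \<omega> $ j)"
  proof (subst AE_all_countable, rule allI)
    fix i
    have "AE \<omega> in M. real_cond_exp M K (\<lambda>\<omega>. V \<omega> $ i) \<omega>
        = real_cond_exp M K (\<lambda>\<omega>. \<Sum>j\<in>UNIV. W \<omega> $ j * V \<omega> $ i) \<omega>"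
      by (rule K.real_cond_exp_cong)
        (use Wb in \<open>auto simp: sum_distrib_right[symmetric] basis_vectors_sum Pi_iff\<close>)
    moreover have "AE \<omega> in M. real_cond_exp M K (\<lambda>\<omega>. \<Sum>j\<in>UNIV. W \<omega> $ j * V \<omega> $ i) \<omega>
        = (\<Sum>j\<in>UNIV. real_cond_exp M K (\<lambda>\<omega>. W \<omega> $ j * V \<omega> $ i) \<omega>)"
      by (rule K.real_cond_exp_sum) (rule iWV)
    moreover have "AE \<omega> in M. \<forall>j. real_cond_exp M K (\<lambda>\<omega>. W \<omega> $ j * V \<omega> $ i) \<omega> = h i j \<omega> * W \<omega> $ j"
      using component by (simp add: AE_all_countable)
    ultimately show "AE \<omega> in M. vec_cond_exp M K V \<omega> $ i = (\<Sum>j\<in>UNIV. h i j \<omega> * W \<omega> $ j)"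
      by eventually_elim (simp add: vec_cond_exp_def)
  qed
  \<comment> \<open>An output of predicted probability zero almost surely does not occur: the event
    \<open>z = 1\<close> belongs to \<open>H\<close>, the integral of \<open>W $ j\<close> over it
    is that of its conditional expectation, namely zero, and \<open>W $ j\<close> is
    nonnegative.\<close>
  have "AE \<omega> in M. \<forall>j. (G *v p \<omega>) $ j = 0 \<longrightarrow> W \<omega> $ j = 0"
  proof (subst AE_all_countable, rule allI)
    fix j
    define z :: "'a \<Rightarrow> real" where "z \<omega> = (if (G *v p \<omega>) $ j = 0 then 1 else 0)" for \<omega>
    have z [measurable]: "z \<in> borel_measurable H"
      unfolding z_def by measurable
    have [measurable]: "z \<in> borel_measurable M"
      using H z by (rule measurable_from_subalg)
    have zW: "integrable M (\<lambda>\<omega>. z \<omega> * W \<omega> $ j)"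
      by (rule Bochner_Integration.integrable_bound[OF iW[of j]], measurable) (simp add: z_def)
    have "AE \<omega> in M. z \<omega> * real_cond_exp M H (\<lambda>\<omega>. W \<omega> $ j) \<omega> = 0"
      using W_cond[of j] by eventually_elim (simp add: z_def)
    then have "(\<integral>\<omega>. z \<omega> * real_cond_exp M H (\<lambda>\<omega>. W \<omega> $ j) \<omega> \<partial>M) = 0"
      by (rule integral_eq_zero_AE)
    then have "(\<integral>\<omega>. z \<omega> * W \<omega> $ j \<partial>M) = 0"
      using H.real_cond_exp_intg(2)[OF zW z] by simp
    moreover have "AE \<omega> in M. 0 \<le> z \<omega> * W \<omega> $ j"
      using basis_vectors_nth[OF funcset_mem[OF Wb], of _ j] by (intro AE_I2) (fastforce simp: z_def)
    ultimately have "AE \<omega> in M. z \<omega> * W \<omega> $ j = 0"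
      using integral_nonneg_eq_0_iff_AE[OF zW] by simp
    then show "AE \<omega> in M. (G *v p \<omega>) $ j = 0 \<longrightarrow> W \<omega> $ j = 0"
      by eventually_elim (auto simp: z_def split: if_splits)
  qed
  with V_cond show ?thesis
    unfolding p_def[symmetric]
  proof eventually_elim
    case (elim \<omega>)
    \<comment> \<open>Where \<open>c\<close> and the inverse of zero could differ, the factor
      \<open>W $ j\<close> vanishes, so the terms agree for every \<open>c\<close>.\<close>
    show ?case
      unfolding vec_eq_iff filter_matrix_nth
      using elim by (auto simp: h_def intro!: sum.cong)
  qed
qed

section \<open>Observation histories as sigma-algebras\<close>

lemma generating_events_Pow: "generating_events M W I \<subseteq> Pow (space M)"
  by (auto simp: generating_events_def)

lemma subalgebra_obs_history:
  assumes "\<And>s. Y s \<in> borel_measurable M"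
  shows "subalgebra M (obs_history M Y I)"
proof -
  have "generating_events M Y I \<subseteq> sets M"
    using assms by (auto simp: generating_events_def)
  then show ?thesis
    using sets.sigma_sets_subset
    by (simp add: subalgebra_def obs_history_def generating_events_Pow)
qed

lemma subalgebra_obs_history_mono:
  assumes "I \<subseteq> J"
  shows "subalgebra (obs_history M Y J) (obs_history M Y I)"
proof -
  have "generating_events M Y I \<subseteq> generating_events M Y J"
    using assms by (auto simp: generating_events_def)
  then show ?thesis
    by (simp add: subalgebra_def obs_history_def generating_events_Pow sigma_sets_mono')
qed

lemma subalgebra_joint_obs_history:
  "subalgebra (joint_history M X Y t) (obs_history M Y {..t})"
  by (simp add: subalgebra_def obs_history_def joint_history_def generating_events_Pow
      sigma_sets_mono')

lemma subalgebra_joint_history: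
  assumes "\<And>s. X s \<in> borel_measurable M" "\<And>s. Y s \<in> borel_measurable M"
  shows "subalgebra M (joint_history M X Y t)"
proof -
  have "generating_events M X {..t} \<union> generating_events M Y {..t} \<subseteq> sets M"
    using assms by (auto simp: generating_events_def)
  then show ?thesis
    using sets.sigma_sets_subset[of _ M]
    by (simp add: subalgebra_def joint_history_def generating_events_Pow del: Un_subset_iff)
qed

lemma obs_history_measurable:
  fixes Y :: "nat \<Rightarrow> 'a \<Rightarrow> real ^ 'm"
  assumes "s \<in> I"
  shows "Y s \<in> borel_measurable (obs_history M Y I)"
proof (rule measurableI)
  fix B :: "(real ^ 'm) set" assume "B \<in> sets borel"
  then have "Y s -` B \<inter> space M \<in> generating_events M Y I"
    unfolding generating_events_def using assms by (intro CollectI exI[of _ s] exI[of _ B]) simp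
  then show "Y s -` B \<inter> space (obs_history M Y I) \<in> sets (obs_history M Y I)"
    by (auto simp: obs_history_def generating_events_Pow)
qed simp

text \<open>The sets with this property form a sigma-algebra, so generators suffice. Those of times
  before \<open>t\<close> already belong to the smaller history; one of time \<open>t\<close> meets
  the event \<open>Y t = y\<close> either in all of it or in nothing, according to whether
  \<open>y\<close> lies in \<open>B\<close>.\<close>

lemma obs_history_trace:
  assumes "C \<in> sets (obs_history M Y {..t})"
  shows "\<exists>D\<in>sets (obs_history M Y {..<t}).
    C \<inter> {\<omega> \<in> space M. Y t \<omega> = y} = D \<inter> {\<omega> \<in> space M. Y t \<omega> = y}"
proof -
  let ?N = "{\<omega> \<in> space M. Y t \<omega> = y}" and ?H = "obs_history M Y {..<t}"
  have space: "space ?H = space M"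
    by (simp add: obs_history_def generating_events_Pow)
  have "C \<in> sigma_sets (space M) (generating_events M Y {..t})"
    using assms by (simp add: obs_history_def generating_events_Pow)
  then show ?thesis
  proof induction
    case (Basic C)
    then obtain s B where sB: "C = Y s -` B \<inter> space M" "s \<le> t" "B \<in> sets borel"
      by (auto simp: generating_events_def)
    show ?case
    proof (cases "s = t")
      case True
      have "C \<inter> ?N = (if y \<in> B then space M else {}) \<inter> ?N"
        using sB(1) True by auto
      moreover have "(if y \<in> B then space M else {}) \<in> sets ?H"
        using sets.top[of ?H] by (simp add: space)
      ultimately show ?thesis
        by blast
    next
      case False
      then have "C \<in> generating_events M Y {..<t}"
        unfolding generating_events_def using sB by (intro CollectI exI[of _ s] exI[of _ B]) simp
      then show ?thesis
        by (auto simp: obs_history_def generating_events_Pow)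
    qed
  next
    case Empty
    then show ?case by auto
  next
    case (Compl C)
    then obtain D where "D \<in> sets ?H" "C \<inter> ?N = D \<inter> ?N"
      by blast
    then show ?case
      using sets.compl_sets[of D ?H] unfolding space by (intro bexI[of _ "space M - D"]) blast+
  next
    case (Union C)
    then have "\<forall>k. \<exists>D. D \<in> sets ?H \<and> C k \<inter> ?N = D \<inter> ?N"
      by blast
    from choice[OF this] obtain D where D: "\<And>k. D k \<in> sets ?H" "\<And>k. C k \<inter> ?N = D k \<inter> ?N"
      by blast
    then have "(\<Union>k. D k) \<in> sets ?H"
      by (intro sets.countable_UN) auto
    moreover have "(\<Union>k. C k) \<inter> ?N = (\<Union>k. D k) \<inter> ?N"
      using D(2) by blast
    ultimately show ?case
      by blast
  qed
qed

section \<open>Prediction and update in the hidden Markov chain\<close>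

context hidden_markov_chain
begin

lemmas subalgebra_obs = subalgebra_obs_history[OF Y_measurable]

lemma X_basis: "X t \<in> space M \<rightarrow> basis_vectors"
  by (simp add: X_values)

lemma Y_basis: "Y t \<in> space M \<rightarrow> basis_vectors"
  by (simp add: Y_values)

text \<open>The initial law is given as a vector-valued integral. Boundedness makes
  \<open>X 0\<close> integrable, and then the coordinate projections, being bounded linear, commute
  with the integral.\<close>

lemma X_component_integral: "expectation (\<lambda>\<omega>. X 0 \<omega> $ i) = p0 $ i"
proof -
  have "integrable M (X 0)"
  proof (rule integrable_const_bound[where B = 1])
    show "AE \<omega> in M. norm (X 0 \<omega>) \<le> 1"
    proof (rule AE_I2)
      fix \<omega> assume "\<omega> \<in> space M"
      then obtain k where "X 0 \<omega> = axis k 1"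
        using X_values[of \<omega> 0] by (auto simp: basis_vectors_def)
      then show "norm (X 0 \<omega>) \<le> 1"
        by simp
    qed
  qed (rule X_measurable)
  then show ?thesis
    using integral_bounded_linear[OF bounded_linear_vec_nth, of M "X 0" i] initial_law by simp
qed

lemma Z_component_integral:
  "expectation (\<lambda>\<omega>. Y 0 \<omega> $ j * X 0 \<omega> $ i) = G $ j $ i * p0 $ i"
proof -
  let ?Z = "\<lambda>\<omega>. kron_vec (Y 0 \<omega>) (X 0 \<omega>)"
  have [measurable]: "X 0 \<in> borel_measurable M" "Y 0 \<in> borel_measurable M"
    by (fact X_measurable Y_measurable)+
  have "integrable M ?Z"
  \<comment> \<open>A crude bound: the norm is at most the sum of the absolute coordinates, each of
    which is 0 or 1.\<close>
  proof (rule integrable_const_bound[where B = "real CARD('m \<times> 'n)"])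
    have "norm (?Z \<omega>) \<le> real CARD('m \<times> 'n)" if "\<omega> \<in> space M" for \<omega>
    proof -
      have Z: "?Z \<omega> $ r = 0 \<or> ?Z \<omega> $ r = 1" for r
        using basis_vectors_nth[OF X_values[OF that, of 0], of "snd r"]
          basis_vectors_nth[OF Y_values[OF that, of 0], of "fst r"]
        by (auto simp: kron_vec_def)
      have "\<bar>?Z \<omega> $ r\<bar> \<le> 1" for r
        using Z[of r] by auto
      then have le: "(\<Sum>r\<in>UNIV. \<bar>?Z \<omega> $ r\<bar>) \<le> (\<Sum>r\<in>(UNIV :: ('m \<times> 'n) set). 1)"
        by (intro sum_mono)
      have "norm (?Z \<omega>) \<le> (\<Sum>r\<in>UNIV. \<bar>?Z \<omega> $ r\<bar>)"
        by (rule norm_le_l1_cart)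
      also note le
      finally show ?thesis by simp
    qed
    then show "AE \<omega> in M. norm (?Z \<omega>) \<le> real CARD('m \<times> 'n)"
      by (intro AE_I2)
    show "?Z \<in> borel_measurable M"
      by (rule borel_measurable_vecI) (simp add: kron_vec_def)
  qed
  then have "expectation (\<lambda>\<omega>. ?Z \<omega> $ (j, i)) = expectation ?Z $ (j, i)"
    by (rule integral_bounded_linear[OF bounded_linear_vec_nth])
  then have "expectation (\<lambda>\<omega>. ?Z \<omega> $ (j, i)) = G $ j $ i * p0 $ i"
    by (simp only: initial_joint Delta_mult_nth)
  then show ?thesis
    by (simp add: kron_vec_def)
qed

text \<open>The index set \<open>{..<0}\<close> is empty, so the history consists of the empty set
  and the whole space, and the constant has the right integral over both.\<close>

lemma real_cond_exp_trivial_history: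
  assumes f: "integrable M f"
  shows "AE \<omega> in M. real_cond_exp M (obs_history M Y {..<0}) f \<omega> = expectation f"
proof -
  let ?F = "obs_history M Y {..<0}"
  interpret F: sigma_finite_subalgebra M ?F
    using subalgebra_obs by (rule sigma_finite_subalgebraI)
  have "sets ?F = {{}, space M}"
    by (simp add: obs_history_def generating_events_def sigma_sets_empty_eq)
  then show ?thesis
    by (intro F.real_cond_exp_charact f)
      (auto simp: set_lebesgue_integral_def prob_space intro!: Bochner_Integration.integral_cong)
qed

text \<open>Tower property: condition first on the joint history, where the transition law applies.
  The result is linear in \<open>X t\<close>, so conditioning it on the observations replaces
  \<open>X t\<close> by its filter.\<close>

lemma joint_step:
  "AE \<omega> in M. real_cond_exp M (obs_history M Y {..t}) (\<lambda>\<omega>. Y (Suc t) \<omega> $ j * X (Suc t) \<omega> $ i) \<omega>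
    = G $ j $ i * (A *v vec_cond_exp M (obs_history M Y {..t}) (X t) \<omega>) $ i"
proof -
  let ?F = "obs_history M Y {..t}" and ?J = "joint_history M X Y t"
  let ?z = "\<lambda>\<omega>. Y (Suc t) \<omega> $ j * X (Suc t) \<omega> $ i"
  interpret F: sigma_finite_subalgebra M ?F
    using subalgebra_obs by (rule sigma_finite_subalgebraI)
  have [measurable]: "X t \<in> borel_measurable M" for t by (fact X_measurable)
  have z: "integrable M ?z"
    by (rule integrable_basis_mult) (intro X_measurable Y_measurable X_basis Y_basis)+
  have iX: "integrable M (\<lambda>\<omega>. X t \<omega> $ k)" for k
    by (rule integrable_basis_nth[OF X_measurable X_basis])
  \<comment> \<open>Component \<open>(j, i)\<close> of the transition law, written as a linear
    combination of the coordinates of \<open>X t\<close> so that conditional expectation can be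
    taken termwise.\<close>
  have "AE \<omega> in M. real_cond_exp M ?J ?z \<omega> = (\<Sum>k\<in>UNIV. G $ j $ i * A $ i $ k * X t \<omega> $ k)"
    using transition[of t]
  proof eventually_elim
    case (elim \<omega>)
    have "real_cond_exp M ?J ?z \<omega> = ((Delta G ** A) *v X t \<omega>) $ (j, i)"
      unfolding elim[symmetric] by (simp add: vec_cond_exp_def kron_vec_def)
    also have "\<dots> = G $ j $ i * (A *v X t \<omega>) $ i"
      by (simp add: matrix_vector_mul_assoc[symmetric] Delta_mult_nth)
    finally show ?case
      by (simp add: matrix_vector_mult_def sum_distrib_left mult.assoc)
  qed
  then have "AE \<omega> in M. real_cond_exp M ?F (real_cond_exp M ?J ?z) \<omega>
      = real_cond_exp M ?F (\<lambda>\<omega>. \<Sum>k\<in>UNIV. G $ j $ i * A $ i $ k * X t \<omega> $ k) \<omega>"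
    by (rule F.real_cond_exp_cong) measurable
  moreover have "AE \<omega> in M. real_cond_exp M ?F (real_cond_exp M ?J ?z) \<omega> = real_cond_exp M ?F ?z \<omega>"
    by (rule F.real_cond_exp_nested_subalg[OF
          subalgebra_joint_history[OF X_measurable Y_measurable] subalgebra_joint_obs_history z])
  moreover have "AE \<omega> in M. real_cond_exp M ?F (\<lambda>\<omega>. \<Sum>k\<in>UNIV. G $ j $ i * A $ i $ k * X t \<omega> $ k) \<omega>
      = (\<Sum>k\<in>UNIV. real_cond_exp M ?F (\<lambda>\<omega>. G $ j $ i * A $ i $ k * X t \<omega> $ k) \<omega>)"
    by (rule F.real_cond_exp_sum) (intro integrable_mult_right iX)
  moreover have "AE \<omega> in M. \<forall>k. real_cond_exp M ?F (\<lambda>\<omega>. G $ j $ i * A $ i $ k * X t \<omega> $ k) \<omega>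
      = G $ j $ i * A $ i $ k * real_cond_exp M ?F (\<lambda>\<omega>. X t \<omega> $ k) \<omega>"
    unfolding AE_all_countable by (intro allI F.real_cond_exp_cmult iX)
  ultimately show ?thesis
    by eventually_elim
      (simp add: matrix_vector_mult_def vec_cond_exp_def sum_distrib_left mult.assoc)
qed

text \<open>Sum \<open>joint_step\<close> over the outputs \<open>j\<close>: the coordinates of
  \<open>Y (Suc t)\<close> and the columns of \<open>G\<close> both sum to one. The history
  \<open>{..<Suc t}\<close> is \<open>{..t}\<close>, written in the form used for
  predictors.\<close>

lemma X_step:
  "AE \<omega> in M. vec_cond_exp M (obs_history M Y {..<Suc t}) (X (Suc t)) \<omega>
    = A *v vec_cond_exp M (obs_history M Y {..t}) (X t) \<omega>"
proof -
  let ?F = "obs_history M Y {..t}"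
  interpret F: sigma_finite_subalgebra M ?F
    using subalgebra_obs by (rule sigma_finite_subalgebraI)
  have [measurable]: "X t \<in> borel_measurable M" "Y t \<in> borel_measurable M" for t
    by (fact X_measurable Y_measurable)+
  have G1: "(\<Sum>j\<in>UNIV. G $ j $ i) = 1" for i
    using G_stochastic by (simp add: column_stochastic_def)
  have "AE \<omega> in M. \<forall>i. real_cond_exp M ?F (\<lambda>\<omega>. X (Suc t) \<omega> $ i) \<omega>
      = (A *v vec_cond_exp M ?F (X t) \<omega>) $ i"
    unfolding AE_all_countable
  proof
    fix i
    have "AE \<omega> in M. real_cond_exp M ?F (\<lambda>\<omega>. X (Suc t) \<omega> $ i) \<omega>
        = real_cond_exp M ?F (\<lambda>\<omega>. \<Sum>j\<in>UNIV. Y (Suc t) \<omega> $ j * X (Suc t) \<omega> $ i) \<omega>"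
      by (rule F.real_cond_exp_cong)
        (auto simp: sum_distrib_right[symmetric] basis_vectors_sum Y_values)
    moreover have "AE \<omega> in M. real_cond_exp M ?F (\<lambda>\<omega>. \<Sum>j\<in>UNIV. Y (Suc t) \<omega> $ j * X (Suc t) \<omega> $ i) \<omega>
        = (\<Sum>j\<in>UNIV. real_cond_exp M ?F (\<lambda>\<omega>. Y (Suc t) \<omega> $ j * X (Suc t) \<omega> $ i) \<omega>)"
      by (rule F.real_cond_exp_sum, rule integrable_basis_mult)
        (intro X_measurable Y_measurable X_basis Y_basis)+
    moreover have "AE \<omega> in M. \<forall>j. real_cond_exp M ?F (\<lambda>\<omega>. Y (Suc t) \<omega> $ j * X (Suc t) \<omega> $ i) \<omega>
        = G $ j $ i * (A *v vec_cond_exp M ?F (X t) \<omega>) $ i"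
      unfolding AE_all_countable by (intro allI joint_step)
    ultimately show "AE \<omega> in M. real_cond_exp M ?F (\<lambda>\<omega>. X (Suc t) \<omega> $ i) \<omega>
        = (A *v vec_cond_exp M ?F (X t) \<omega>) $ i"
      by eventually_elim (simp add: sum_distrib_right[symmetric] G1)
  qed
  then show ?thesis
    by eventually_elim (simp add: vec_eq_iff vec_cond_exp_def lessThan_Suc_atMost)
qed

text \<open>Sum \<open>joint_step\<close> over the states \<open>i\<close> instead; the sum on the
  right is then a product with \<open>G\<close>.\<close>

lemma Y_step:
  "AE \<omega> in M. vec_cond_exp M (obs_history M Y {..t}) (Y (Suc t)) \<omega>
    = G *v (A *v vec_cond_exp M (obs_history M Y {..t}) (X t) \<omega>)"
proof -
  let ?F = "obs_history M Y {..t}"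
  interpret F: sigma_finite_subalgebra M ?F
    using subalgebra_obs by (rule sigma_finite_subalgebraI)
  have [measurable]: "X t \<in> borel_measurable M" "Y t \<in> borel_measurable M" for t
    by (fact X_measurable Y_measurable)+
  have "AE \<omega> in M. \<forall>j. real_cond_exp M ?F (\<lambda>\<omega>. Y (Suc t) \<omega> $ j) \<omega>
      = (G *v (A *v vec_cond_exp M ?F (X t) \<omega>)) $ j"
    unfolding AE_all_countable
  proof
    fix j
    have "AE \<omega> in M. real_cond_exp M ?F (\<lambda>\<omega>. Y (Suc t) \<omega> $ j) \<omega>
        = real_cond_exp M ?F (\<lambda>\<omega>. \<Sum>i\<in>UNIV. Y (Suc t) \<omega> $ j * X (Suc t) \<omega> $ i) \<omega>"
      by (rule F.real_cond_exp_cong)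
        (auto simp: sum_distrib_left[symmetric] basis_vectors_sum X_values)
    moreover have "AE \<omega> in M. real_cond_exp M ?F (\<lambda>\<omega>. \<Sum>i\<in>UNIV. Y (Suc t) \<omega> $ j * X (Suc t) \<omega> $ i) \<omega>
        = (\<Sum>i\<in>UNIV. real_cond_exp M ?F (\<lambda>\<omega>. Y (Suc t) \<omega> $ j * X (Suc t) \<omega> $ i) \<omega>)"
      by (rule F.real_cond_exp_sum, rule integrable_basis_mult)
        (intro X_measurable Y_measurable X_basis Y_basis)+
    moreover have "AE \<omega> in M. \<forall>i. real_cond_exp M ?F (\<lambda>\<omega>. Y (Suc t) \<omega> $ j * X (Suc t) \<omega> $ i) \<omega>
        = G $ j $ i * (A *v vec_cond_exp M ?F (X t) \<omega>) $ i"
      unfolding AE_all_countable by (intro allI joint_step)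
    ultimately show "AE \<omega> in M. real_cond_exp M ?F (\<lambda>\<omega>. Y (Suc t) \<omega> $ j) \<omega>
        = (G *v (A *v vec_cond_exp M ?F (X t) \<omega>)) $ j"
      by eventually_elim (simp add: matrix_vector_mult_def[of G])
  qed
  then show ?thesis
    by eventually_elim (simp add: vec_eq_iff vec_cond_exp_def)
qed

lemma X_initial:
  "AE \<omega> in M. vec_cond_exp M (obs_history M Y {..<0}) (X 0) \<omega> = p0"
proof -
  have "AE \<omega> in M. \<forall>i. real_cond_exp M (obs_history M Y {..<0}) (\<lambda>\<omega>. X 0 \<omega> $ i) \<omega> = p0 $ i"
    unfolding AE_all_countable X_component_integral[symmetric]
    by (intro allI real_cond_exp_trivial_history integrable_basis_nth X_measurable X_basis)
  then show ?thesis
    by eventually_elim (simp add: vec_eq_iff vec_cond_exp_def)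
qed

text \<open>This supplies the joint law required by \<open>bayes_update\<close> uniformly in
  \<open>t\<close>: at time 0 from the initial joint law over the trivial history, later from
  \<open>joint_step\<close>, with \<open>X_step\<close> identifying the predictor.\<close>

lemma joint_prediction:
  "AE \<omega> in M. real_cond_exp M (obs_history M Y {..<t}) (\<lambda>\<omega>. Y t \<omega> $ j * X t \<omega> $ i) \<omega>
    = G $ j $ i * vec_cond_exp M (obs_history M Y {..<t}) (X t) \<omega> $ i"
proof (cases t)
  case 0
  have "AE \<omega> in M. real_cond_exp M (obs_history M Y {..<0}) (\<lambda>\<omega>. Y 0 \<omega> $ j * X 0 \<omega> $ i) \<omega>
      = G $ j $ i * p0 $ i"
    unfolding Z_component_integral[symmetric]
    by (intro real_cond_exp_trivial_history integrable_basis_mult X_measurable Y_measurable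
        X_basis Y_basis)
  with X_initial show ?thesis
    unfolding 0 by eventually_elim simp
next
  case (Suc s)
  show ?thesis
    using joint_step[of s j i] X_step[of s] unfolding Suc
    by eventually_elim (simp add: lessThan_Suc_atMost)
qed

text \<open>Bayes' rule with prior history \<open>{..<t}\<close>, posterior history
  \<open>{..t}\<close>, hidden vector \<open>X t\<close> and observed vector
  \<open>Y t\<close>.\<close>

lemma filter_update:
  "AE \<omega> in M. \<forall>c. vec_cond_exp M (obs_history M Y {..t}) (X t) \<omega> =
    (diag (vec_cond_exp M (obs_history M Y {..<t}) (X t) \<omega>) ** transpose G
      ** diag_inv c (G *v vec_cond_exp M (obs_history M Y {..<t}) (X t) \<omega>)) *v Y t \<omega>"
proof (rule bayes_update)
  show "subalgebra (obs_history M Y {..t}) (obs_history M Y {..<t})"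
    by (rule subalgebra_obs_history_mono) auto
  show "Y t \<in> borel_measurable (obs_history M Y {..t})"
    by (rule obs_history_measurable) simp
  show "0 \<le> G $ j $ i" for i j
    using G_stochastic by (simp add: column_stochastic_def)
qed (auto intro: subalgebra_obs obs_history_trace joint_prediction X_measurable X_values Y_values)

end

section \<open>The filter and prediction recursions\<close>

theorem theorem5p6:
  fixes M :: "'a measure"
    and X :: "nat \<Rightarrow> 'a \<Rightarrow> real ^ 'n"
    and Y :: "nat \<Rightarrow> 'a \<Rightarrow> real ^ 'm"
    and A :: "real ^ 'n ^ 'n"
    and G :: "real ^ 'n ^ 'm"
    and p0 :: "real ^ 'n"
    and Xfilt Xpred :: "nat \<Rightarrow> 'a \<Rightarrow> real ^ 'n"
    and Ypred :: "nat \<Rightarrow> 'a \<Rightarrow> real ^ 'm"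
  assumes hmc: "hidden_markov_chain M X Y A G p0"
    and Xfilt: "\<And>t. Xfilt t = vec_cond_exp M (obs_history M Y {..t}) (X t)"
    and Xpred: "\<And>t. Xpred t = vec_cond_exp M (obs_history M Y {..<t}) (X t)"
    and Ypred: "\<And>t. Ypred t = vec_cond_exp M (obs_history M Y {..t}) (Y (Suc t))"
  shows
    "(\<forall>t. represents_cond_distr M (obs_history M Y {..t}) (X t) (Xfilt t)) \<and>
     (AE \<omega> in M. \<forall>c. Xfilt 0 \<omega> = (diag p0 ** transpose G ** diag_inv c (G *v p0)) *v Y 0 \<omega>) \<and>
     (AE \<omega> in M. \<forall>t\<ge>1. \<forall>c. Xfilt t \<omega> =
        (diag (A *v Xfilt (t - 1) \<omega>) ** transpose G
           ** diag_inv c ((G ** A) *v Xfilt (t - 1) \<omega>)) *v Y t \<omega>) \<and>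
     (\<forall>t. represents_cond_distr M (obs_history M Y {..<t}) (X t) (Xpred t)) \<and>
     (AE \<omega> in M. Xpred 0 \<omega> = integral\<^sup>L M (X 0)) \<and> integral\<^sup>L M (X 0) = p0 \<and>
     (AE \<omega> in M. \<forall>t c. Xpred (Suc t) \<omega> =
        (A ** diag (Xpred t \<omega>) ** transpose G ** diag_inv c (G *v Xpred t \<omega>)) *v Y t \<omega>) \<and>
     (AE \<omega> in M. \<forall>t c. Ypred t \<omega> =
        (G ** A ** diag (Xpred t \<omega>) ** transpose G ** diag_inv c (G *v Xpred t \<omega>)) *v Y t \<omega>)"
proof -
  interpret hidden_markov_chain M X Y A G p0
    by (fact hmc)
  have initial: "AE \<omega> in M. Xpred 0 \<omega> = p0"
    using X_initial by (simp add: Xpred)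
  have step: "AE \<omega> in M. \<forall>t. Xpred (Suc t) \<omega> = A *v Xfilt t \<omega>"
    unfolding AE_all_countable Xpred Xfilt by (intro allI X_step)
  have Ystep: "AE \<omega> in M. \<forall>t. Ypred t \<omega> = G *v (A *v Xfilt t \<omega>)"
    unfolding AE_all_countable Ypred Xfilt by (intro allI Y_step)
  have update: "AE \<omega> in M. \<forall>t c. Xfilt t \<omega> =
      (diag (Xpred t \<omega>) ** transpose G ** diag_inv c (G *v Xpred t \<omega>)) *v Y t \<omega>"
    \<comment> \<open>Fixing the index type to \<open>nat\<close> moves only the quantifier over
      times out of the almost sure statement; the one over \<open>c\<close> has an uncountable range
      and must stay inside.\<close>
    unfolding AE_all_countable[where 'i = nat] Xpred Xfilt by (intro allI filter_update)
  have "\<forall>t. represents_cond_distr M (obs_history M Y {..t}) (X t) (Xfilt t)"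
    "\<forall>t. represents_cond_distr M (obs_history M Y {..<t}) (X t) (Xpred t)"
    unfolding Xfilt Xpred
    by (intro allI represents_cond_distr_vec_cond_exp subalgebra_obs X_measurable X_basis)+
  moreover have "AE \<omega> in M. \<forall>c. Xfilt 0 \<omega> = (diag p0 ** transpose G ** diag_inv c (G *v p0)) *v Y 0 \<omega>"
    using initial update by eventually_elim metis
  moreover have "AE \<omega> in M. \<forall>t\<ge>1. \<forall>c. Xfilt t \<omega> =
      (diag (A *v Xfilt (t - 1) \<omega>) ** transpose G
         ** diag_inv c ((G ** A) *v Xfilt (t - 1) \<omega>)) *v Y t \<omega>"
    using step update
  proof eventually_elim
    case (elim \<omega>)
    \<comment> \<open>The condition on \<open>t\<close> matters because subtraction on
      \<open>nat\<close> truncates: at 0 the right-hand side would refer to time 0 itself.\<close>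
    have "Xpred t \<omega> = A *v Xfilt (t - 1) \<omega>" if "t \<ge> 1" for t
      using elim(1) that by (metis One_nat_def Suc_pred less_eq_Suc_le)
    then show ?case
      using elim(2) by (metis matrix_vector_mul_assoc)
  qed
  moreover have "AE \<omega> in M. Xpred 0 \<omega> = integral\<^sup>L M (X 0)"
    using initial initial_law by simp
  \<comment> \<open>Predict after updating: \<open>A\<close> is applied to the updated filter and
    absorbed into the matrix product. The output forecast below arises in the same way with
    \<open>G ** A\<close>.\<close>
  moreover have "AE \<omega> in M. \<forall>t c. Xpred (Suc t) \<omega> =
      (A ** diag (Xpred t \<omega>) ** transpose G ** diag_inv c (G *v Xpred t \<omega>)) *v Y t \<omega>"
    using step update
    by eventually_elim (metis matrix_vector_mul_assoc matrix_mul_assoc)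
  moreover have "AE \<omega> in M. \<forall>t c. Ypred t \<omega> =
      (G ** A ** diag (Xpred t \<omega>) ** transpose G ** diag_inv c (G *v Xpred t \<omega>)) *v Y t \<omega>"
    using Ystep update
    by eventually_elim (metis matrix_vector_mul_assoc matrix_mul_assoc)
  ultimately show ?thesis
    using initial_law by simp
qed

end
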